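(* Let $1\le p<\infty$. Then: (1) the pairs $(\ell_1,\ell_p)$ and $(\ell_1,c_0)$ do not satisfy the weak minimizing property; (2) the pair $(c_0,\ell_p)$ does not satisfy the weak minimizing property; (3) the pair $(c_0,c_0)$ does not satisfy the weak minimizing property.
   Context: For Banach spaces $X,Y$, $\mathcal{L}(X,Y)$ denotes the space of bounded linear operators from $X$ to $Y$, and $S_X$ the unit sphere of $X$. The minimum modulus of $T\in\mathcal{L}(X,Y)$ is $m(T)=\inf\{\|Tx\|:x\in S_X\}$; $T$ attains its minimum modulus if $\|Tx\|=m(T)$ for some $x\in S_X$. A minimizing sequence for $T$ is a sequence $(x_n)_n$ in $S_X$ with $\|Tx_n\|\to m(T)$. The pair $(X,Y)$ has the weak minimizing property (WmP) if every $T\in\mathcal{L}(X,Y)$ that admits a non-weakly null minimizing sequence (i.e. one that does not converge weakly to $0$) attains its minimum modulus. *)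

theory Defs
  imports Complex_Main "HOL-Library.Function_Algebras"
begin

text \<open>
  The exponent \<open>p\<close> of \<open>l\<^sub>p\<close> is a term, so the spaces cannot be types of class \<open>banach\<close>. A normed
  space is given by a carrier, a scalar multiplication and a norm; addition is that of the ambient
  type. The scalars are an arbitrary complete \<open>real_normed_field\<close>; the real and the complex numbers
  are instances, and by the Gelfand-Mazur theorem every instance is isometrically isomorphic to one
  of these two.
\<close>

record ('k, 'a) normed_sp =
  carrier :: "'a set"
  smul :: "'k \<Rightarrow> 'a \<Rightarrow> 'a"
  nrm :: "'a \<Rightarrow> real"

definition scalars :: "('k::{real_normed_field,banach}, 'k) normed_sp" where
  "scalars = \<lparr>carrier = UNIV, smul = (*), nrm = norm\<rparr>"

definition bounded_ops ::
    "('k::{real_normed_field,banach}, 'a::ab_group_add) normed_sp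
      \<Rightarrow> ('k, 'b::ab_group_add) normed_sp \<Rightarrow> ('a \<Rightarrow> 'b) set" where
  "bounded_ops X Y = {T.
     (\<forall>x\<in>carrier X. T x \<in> carrier Y) \<and>
     (\<forall>x\<in>carrier X. \<forall>y\<in>carrier X. T (x + y) = T x + T y) \<and>
     (\<forall>c. \<forall>x\<in>carrier X. T (smul X c x) = smul Y c (T x)) \<and>
     (\<exists>C. \<forall>x\<in>carrier X. nrm Y (T x) \<le> C * nrm X x)}"

definition unit_sphere :: "('k, 'a) normed_sp \<Rightarrow> 'a set" where
  "unit_sphere X = {x \<in> carrier X. nrm X x = 1}"

definition min_modulus ::
    "('k, 'a) normed_sp \<Rightarrow> ('k, 'b) normed_sp \<Rightarrow> ('a \<Rightarrow> 'b) \<Rightarrow> real" where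
  "min_modulus X Y T = (INF x\<in>unit_sphere X. nrm Y (T x))"

definition attains_min_modulus ::
    "('k, 'a) normed_sp \<Rightarrow> ('k, 'b) normed_sp \<Rightarrow> ('a \<Rightarrow> 'b) \<Rightarrow> bool" where
  "attains_min_modulus X Y T \<longleftrightarrow> (\<exists>x\<in>unit_sphere X. nrm Y (T x) = min_modulus X Y T)"

definition minimizing_seq ::
    "('k, 'a) normed_sp \<Rightarrow> ('k, 'b) normed_sp \<Rightarrow> ('a \<Rightarrow> 'b) \<Rightarrow> (nat \<Rightarrow> 'a) \<Rightarrow> bool" where
  "minimizing_seq X Y T x \<longleftrightarrow>
     (\<forall>n. x n \<in> unit_sphere X) \<and> (\<lambda>n. nrm Y (T (x n))) \<longlonglongrightarrow> min_modulus X Y T"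

definition weakly_null ::
    "('k::{real_normed_field,banach}, 'a::ab_group_add) normed_sp \<Rightarrow> (nat \<Rightarrow> 'a) \<Rightarrow> bool" where
  "weakly_null X x \<longleftrightarrow> (\<forall>f\<in>bounded_ops X scalars. (\<lambda>n. f (x n)) \<longlonglongrightarrow> 0)"

definition weak_minimizing_property ::
    "('k::{real_normed_field,banach}, 'a::ab_group_add) normed_sp
      \<Rightarrow> ('k, 'b::ab_group_add) normed_sp \<Rightarrow> bool" where
  "weak_minimizing_property X Y \<longleftrightarrow>
     (\<forall>T\<in>bounded_ops X Y.
        (\<exists>x. minimizing_seq X Y T x \<and> \<not> weakly_null X x) \<longrightarrow> attains_min_modulus X Y T)"

type_synonym 'k sequence_space = "('k, nat \<Rightarrow> 'k) normed_sp"

definition lp :: "real \<Rightarrow> 'k::{real_normed_field,banach} sequence_space" where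
  "lp p = \<lparr>carrier = {x. summable (\<lambda>n. norm (x n) powr p)},
           smul = (\<lambda>c x n. c * x n),
           nrm = (\<lambda>x. (\<Sum>n. norm (x n) powr p) powr (1 / p))\<rparr>"

definition c0 :: "'k::{real_normed_field,banach} sequence_space" where
  "c0 = \<lparr>carrier = {x. x \<longlonglongrightarrow> 0},
         smul = (\<lambda>c x n. c * x n),
         nrm = (\<lambda>x. SUP n. norm (x n))\<rparr>"

end

(* The weighted difference operator T x = (2^-n (x n - x (n+1))) is bounded from c0 or l1 into every
   lp and into c0. It is injective on null sequences, because only constant sequences are in its
   kernel. It sends the multiple a * (1, ..., 1, 0, 0, ...) (last 1 at index m) to the vector with
   single entry a * 2^-m. Hence the normalized initial segments of the constant sequence form a
   minimizing sequence, the minimum modulus is 0, and it is not attained. These segments are not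
   weakly null: in c0 the first coordinate is always 1, and in l1 the sum of the coordinates is. *)

theory Submission
  imports Defs
begin

section \<open>The difference operator and a criterion for failure of the property\<close>

definition difference_op :: "(nat \<Rightarrow> 'k::real_normed_field) \<Rightarrow> nat \<Rightarrow> 'k" where
  "difference_op x n = (1/2) ^ n *\<^sub>R (x n - x (Suc n))"

text \<open>The height is a parameter because normalization depends on the domain: 1 in
  \<open>c0\<close>, but \<open>1 / (m + 1)\<close> in \<open>lp 1\<close>.\<close>

definition initial_segment :: "'k::real_normed_field \<Rightarrow> nat \<Rightarrow> nat \<Rightarrow> 'k" where
  "initial_segment a m i = (if i \<le> m then a else 0)"

text \<open>Collects what the argument uses of the domain. Coordinates dominated by the norm make
  \<open>difference_op\<close> bounded, convergence to 0 makes it injective, and a functional equal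
  to 1 on all normalized segments certifies that these are not weakly null.\<close>

definition admissible_domain :: "'k::{real_normed_field,banach} sequence_space \<Rightarrow> bool" where
  "admissible_domain X \<longleftrightarrow>
     smul X = (\<lambda>c x n. c * x n) \<and> nrm X 0 = 0 \<and>
     (\<forall>x\<in>carrier X. x \<longlonglongrightarrow> 0 \<and> (\<forall>n. norm (x n) \<le> nrm X x)) \<and>
     (\<exists>a f. (\<forall>m. initial_segment (a m) m \<in> unit_sphere X) \<and>
            f \<in> bounded_ops X scalars \<and> (\<forall>m. f (initial_segment (a m) m) = 1))"

text \<open>The last clause puts images under \<open>difference_op\<close> in the codomain; its
  \<open>K\<close> depends on neither \<open>C\<close> nor \<open>y\<close> and so yields an
  operator bound. The clause on single entries computes the norm of the image of a segment.\<close>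

definition admissible_codomain :: "'k::{real_normed_field,banach} sequence_space \<Rightarrow> bool" where
  "admissible_codomain Y \<longleftrightarrow>
     smul Y = (\<lambda>c x n. c * x n) \<and>
     (\<forall>y\<in>carrier Y. 0 \<le> nrm Y y \<and> (nrm Y y = 0 \<longrightarrow> y = 0)) \<and>
     (\<forall>n c. nrm Y (\<lambda>i. if i = n then c else 0) = norm c) \<and>
     (\<exists>K. \<forall>C y. (\<forall>n. norm (y n) \<le> C * (1/2) ^ n) \<longrightarrow> y \<in> carrier Y \<and> nrm Y y \<le> K * C)"

lemma difference_op_initial_segment:
  "difference_op (initial_segment a m) = (\<lambda>i. if i = m then (1/2) ^ m *\<^sub>R a else 0)"
  by (auto simp: fun_eq_iff difference_op_def initial_segment_def)

lemma difference_op_eq_0D: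
  assumes "difference_op x = 0" "x \<longlonglongrightarrow> 0"
  shows "x = 0"
proof -
  have step: "x (Suc n) = x n" for n
    using fun_cong[OF assms(1), of n] by (simp add: difference_op_def)
  have "x n = x 0" for n
    by (induction n) (simp_all add: step)
  then have const: "x = (\<lambda>n. x 0)"
    by (simp add: fun_eq_iff)
  then have "(\<lambda>n::nat. x 0) \<longlonglongrightarrow> 0"
    using assms(2) by simp
  then have "x 0 = 0"
    by (simp add: LIMSEQ_const_iff)
  then show ?thesis
    using const by (simp add: fun_eq_iff)
qed

lemma norm_difference_op_le:
  assumes "\<And>n. norm (x n) \<le> B"
  shows "norm (difference_op x n) \<le> (2 * B) * (1/2) ^ n"
proof -
  have "norm (x n - x (Suc n)) \<le> 2 * B"
    using norm_triangle_ineq4[of "x n" "x (Suc n)"] assms[of n] assms[of "Suc n"] by linarith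
  then have "(1/2) ^ n * norm (x n - x (Suc n)) \<le> (1/2) ^ n * (2 * B)"
    by (rule mult_left_mono) simp
  then show ?thesis
    by (simp add: difference_op_def mult.commute)
qed

lemma difference_op_bounded:
  assumes "admissible_domain X" "admissible_codomain Y"
  shows "difference_op \<in> bounded_ops X Y"
proof -
  obtain K where K: "\<And>C y. (\<And>n. norm (y n) \<le> C * (1/2) ^ n) \<Longrightarrow> y \<in> carrier Y \<and> nrm Y y \<le> K * C"
    using assms(2) unfolding admissible_codomain_def by blast
  have "difference_op x \<in> carrier Y \<and> nrm Y (difference_op x) \<le> K * (2 * nrm X x)"
    if "x \<in> carrier X" for x
    using assms(1) that by (intro K norm_difference_op_le) (auto simp: admissible_domain_def)
  \<comment> \<open>\<open>bounded_ops\<close> asks for a constant times \<open>nrm X x\<close>;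
    reassociating exhibits the constant \<open>K * 2\<close>.\<close>
  moreover have "K * (2 * r) = (K * 2) * r" for r :: real
    by simp
  moreover have "difference_op (x + y) = difference_op x + difference_op y" for x y :: "nat \<Rightarrow> 'a"
    by (simp add: fun_eq_iff difference_op_def algebra_simps)
  moreover have "difference_op (\<lambda>n. c * x n) = (\<lambda>n. c * difference_op x n)" for c and x :: "nat \<Rightarrow> 'a"
    by (simp add: fun_eq_iff difference_op_def algebra_simps)
  moreover have "smul X = (\<lambda>c x n. c * x n)" "smul Y = (\<lambda>c x n. c * x n)"
    using assms by (simp_all add: admissible_domain_def admissible_codomain_def)
  ultimately show ?thesis
    unfolding bounded_ops_def by auto
qed

lemma not_weak_minimizing_property:
  assumes X: "admissible_domain X" and Y: "admissible_codomain Y"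
  shows "\<not> weak_minimizing_property X Y"
proof
  assume W: "weak_minimizing_property X Y"
  let ?T = difference_op
  have T: "?T \<in> bounded_ops X Y"
    using X Y by (rule difference_op_bounded)
  obtain a f where a: "\<And>m. initial_segment (a m) m \<in> unit_sphere X"
    and f: "f \<in> bounded_ops X scalars" and f1: "\<And>m. f (initial_segment (a m) m) = 1"
    using X unfolding admissible_domain_def by blast
  let ?x = "\<lambda>m. initial_segment (a m) m"
  have nrm_T: "nrm Y (?T (?x m)) = (1/2) ^ m * norm (a m)" for m
    using Y by (simp add: difference_op_initial_segment admissible_codomain_def)
  have coord: "norm (x n) \<le> nrm X x" if "x \<in> carrier X" for x n
    using X that by (simp add: admissible_domain_def)
  \<comment> \<open>Every segment has its height at index 0, so the coordinate bound there, applied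
    to a unit vector, bounds the height by 1.\<close>
  have "norm (a m) \<le> 1" for m
    using a[of m] coord[of "?x m" 0] by (simp add: unit_sphere_def initial_segment_def)
  then have "norm (nrm Y (?T (?x m))) \<le> (1/2) ^ m" for m
    by (simp add: nrm_T abs_mult mult_le_one mult_left_le)
  then have lim: "(\<lambda>m. nrm Y (?T (?x m))) \<longlonglongrightarrow> 0"
    by (intro tendsto_0_le[OF LIMSEQ_power_zero[of "1/2::real"], where K=1]) auto
  have nonneg: "0 \<le> nrm Y (?T x)" if "x \<in> unit_sphere X" for x
    using T Y that by (auto simp: bounded_ops_def unit_sphere_def admissible_codomain_def)
  then have bdd: "bdd_below ((\<lambda>x. nrm Y (?T x)) ` unit_sphere X)"
    by (intro bdd_belowI2[where m=0])
  have mod0: "min_modulus X Y ?T = 0"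
  proof (rule antisym)
    have "min_modulus X Y ?T \<le> nrm Y (?T (?x m))" for m
      unfolding min_modulus_def by (rule cINF_lower[OF bdd a])
    then show "min_modulus X Y ?T \<le> 0"
      by (intro LIMSEQ_le_const[OF lim]) auto
    show "0 \<le> min_modulus X Y ?T"
      unfolding min_modulus_def using a nonneg by (intro cINF_greatest) auto
  qed
  have "minimizing_seq X Y ?T ?x"
    using a lim by (simp add: minimizing_seq_def mod0)
  \<comment> \<open>\<open>f\<close> is constantly 1 along the sequence, so its values cannot tend
    to 0.\<close>
  moreover have "\<not> weakly_null X ?x"
    using f f1 by (auto simp: weakly_null_def LIMSEQ_const_iff intro!: bexI[of _ f])
  ultimately obtain x where x: "x \<in> unit_sphere X" and Tx: "nrm Y (?T x) = 0"
    using W T mod0 unfolding weak_minimizing_property_def attains_min_modulus_def by fastforce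
  have "?T x = 0"
    using T Y x Tx by (auto simp: bounded_ops_def unit_sphere_def admissible_codomain_def)
  moreover have "x \<longlonglongrightarrow> 0"
    using X x by (simp add: unit_sphere_def admissible_domain_def)
  ultimately have "x = 0"
    by (rule difference_op_eq_0D)
  then show False
    using X x by (simp add: unit_sphere_def admissible_domain_def)
qed

section \<open>The domains \<open>lp 1\<close> and \<open>c0\<close>\<close>

lemma carrier_l1: "carrier (lp 1) = {x. summable (\<lambda>n. norm (x n))}"
  by (simp add: lp_def)

text \<open>\<open>powr 1\<close> is the identity only on nonnegative reals; for the outer power
  this needs the sum to be nonnegative, which summability ensures.\<close>

lemma nrm_l1: "summable (\<lambda>n. norm (x n)) \<Longrightarrow> nrm (lp 1) x = (\<Sum>n. norm (x n))"
  by (simp add: lp_def suminf_nonneg)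

text \<open>A real supremum dominates its family only if that family is bounded above; convergent
  sequences are bounded.\<close>

lemma norm_le_nrm_c0:
  assumes "x \<longlonglongrightarrow> 0"
  shows "norm (x n) \<le> nrm c0 x"
proof -
  have "Bseq x"
    using assms by (auto intro: convergent_imp_Bseq convergentI)
  then have "bdd_above (range (\<lambda>n. norm (x n)))"
    by (auto elim!: BseqE intro: bdd_aboveI2)
  then show ?thesis
    by (auto simp: c0_def intro: cSUP_upper)
qed

lemma admissible_domain_c0: "admissible_domain (c0 :: 'k::{real_normed_field,banach} sequence_space)"
proof -
  have seg: "initial_segment (1::'k) m \<in> unit_sphere c0" for m
  proof -
    have "initial_segment 1 m \<longlonglongrightarrow> (0::'k)"
      by (rule tendsto_eventually)
         (auto simp: initial_segment_def eventually_sequentially intro: exI[of _ "Suc m"])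
    \<comment> \<open>The supremum is a maximum, attained at index 0 for every
      \<open>m\<close>.\<close>
    moreover have "(SUP n. norm (initial_segment (1::'k) m n)) = 1"
      by (rule cSup_eq_maximum) (auto simp: initial_segment_def intro!: image_eqI[of _ _ 0])
    ultimately show ?thesis
      by (simp add: unit_sphere_def c0_def)
  qed
  have "(\<lambda>x. x 0) \<in> bounded_ops c0 (scalars :: ('k, 'k) normed_sp)"
    using norm_le_nrm_c0[of _ 0]
    by (auto simp: bounded_ops_def scalars_def c0_def intro!: exI[of _ 1])
  moreover have "initial_segment 1 m 0 = (1::'k)" for m
    by (simp add: initial_segment_def)
  ultimately have "\<exists>a f. (\<forall>m. initial_segment (a m) m \<in> unit_sphere c0) \<and>
      f \<in> bounded_ops c0 (scalars :: ('k, 'k) normed_sp) \<and> (\<forall>m. f (initial_segment (a m) m) = 1)"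
    using seg by (intro exI[of _ "\<lambda>m. 1"] exI[of _ "\<lambda>x. x 0"]) auto
  then show ?thesis
    using norm_le_nrm_c0 by (auto simp: admissible_domain_def c0_def)
qed

text \<open>A segment ending at index \<open>m\<close> has \<open>m + 1\<close> equal entries, so
  the height \<open>1 / (m + 1)\<close> makes both its norm and its coordinate sum 1. The functional
  is therefore \<open>suminf\<close>.\<close>

lemma admissible_domain_l1: "admissible_domain (lp 1 :: 'k::{real_normed_field,banach} sequence_space)"
proof -
  let ?a = "\<lambda>m. inverse (of_nat (Suc m)) :: 'k"
  \<comment> \<open>The field is generic because the sum is taken twice: over the reals for the norm
    and over \<open>'k\<close> for the functional.\<close>
  have sums: "(\<lambda>i. initial_segment a m i) sums (of_nat (Suc m) * a)" for a :: "'b::real_normed_field" and m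
    using sums_finite[of "{..m}" "initial_segment a m"]
    by (simp add: initial_segment_def[abs_def])
  have norm_seg: "norm (initial_segment a m i) = initial_segment (norm a) m i" for a :: 'k and m i
    by (simp add: initial_segment_def)
  have norm_a: "of_nat (Suc m) * norm (?a m) = 1" for m
    by (simp add: norm_inverse del: of_nat_Suc)
  have seg: "initial_segment (?a m) m \<in> unit_sphere (lp 1)" for m
    using sums[of "norm (?a m)" m] norm_a[of m]
    by (simp add: unit_sphere_def carrier_l1 nrm_l1 norm_seg sums_iff del: of_nat_Suc)
  have suminf_seg: "suminf (initial_segment (?a m) m) = 1" for m
    using sums[of "?a m" m] by (simp add: sums_iff del: of_nat_Suc)
  \<comment> \<open>\<open>suminf\<close> is meaningful only on convergent series. Members of
    \<open>lp 1\<close> are absolutely summable, hence summable by completeness of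
    \<open>'k\<close>.\<close>
  have bound: "norm (suminf x) \<le> 1 * nrm (lp 1) x" if "x \<in> carrier (lp 1)" for x :: "nat \<Rightarrow> 'k"
    using that by (simp add: carrier_l1 nrm_l1 summable_norm)
  have add: "suminf (x + y) = suminf x + suminf y"
    if "x \<in> carrier (lp 1)" "y \<in> carrier (lp 1)" for x y :: "nat \<Rightarrow> 'k"
    using suminf_add[of x y] that by (simp add: carrier_l1 summable_norm_cancel plus_fun_def)
  have mult: "suminf (smul (lp 1) c x) = c * suminf x" if "x \<in> carrier (lp 1)" for c and x :: "nat \<Rightarrow> 'k"
    using suminf_mult[of x c] that unfolding carrier_l1 by (simp add: lp_def summable_norm_cancel)
  have "suminf \<in> bounded_ops (lp 1) (scalars :: ('k, 'k) normed_sp)"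
    unfolding bounded_ops_def scalars_def normed_sp.simps
    by (intro CollectI conjI ballI allI exI[of _ 1] UNIV_I add mult bound)
  then have "\<exists>a f. (\<forall>m. initial_segment (a m) m \<in> unit_sphere (lp 1)) \<and>
      f \<in> bounded_ops (lp 1) (scalars :: ('k, 'k) normed_sp) \<and> (\<forall>m. f (initial_segment (a m) m) = 1)"
    using seg suminf_seg by (intro exI[of _ ?a] exI[of _ suminf] conjI allI)
  moreover have "x \<longlonglongrightarrow> 0 \<and> (\<forall>n. norm (x n) \<le> nrm (lp 1) x)" if "x \<in> carrier (lp 1)" for x :: "nat \<Rightarrow> 'k"
  proof (intro conjI allI)
    have summ: "summable (\<lambda>n. norm (x n))"
      using that by (simp add: carrier_l1)
    show "x \<longlonglongrightarrow> 0"
      by (rule summable_LIMSEQ_zero[OF summable_norm_cancel[OF summ]])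
    show "norm (x n) \<le> nrm (lp 1) x" for n
      using sum_le_suminf[OF summ, of "{n}"] by (simp add: nrm_l1 summ)
  qed
  moreover have "smul (lp 1) = (\<lambda>c x n. c * (x n :: 'k))" "nrm (lp 1) (0 :: nat \<Rightarrow> 'k) = 0"
    by (simp_all add: lp_def)
  ultimately show ?thesis
    unfolding admissible_domain_def by blast
qed

section \<open>The codomains \<open>c0\<close> and \<open>lp p\<close>\<close>

lemma admissible_codomain_c0: "admissible_codomain (c0 :: 'k::{real_normed_field,banach} sequence_space)"
proof -
  have "0 \<le> nrm c0 y \<and> (nrm c0 y = 0 \<longrightarrow> y = 0)" if "y \<longlonglongrightarrow> 0" for y :: "nat \<Rightarrow> 'k"
  proof (intro conjI impI)
    show "0 \<le> nrm c0 y"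
      using norm_le_nrm_c0[OF that, of 0] norm_ge_zero order_trans by blast
    assume "nrm c0 y = 0"
    then show "y = 0"
      using norm_le_nrm_c0[OF that] by (simp add: fun_eq_iff)
  qed
  moreover have "nrm c0 (\<lambda>i. if i = n then c else 0) = norm c" for n and c :: 'k
    unfolding c0_def by (auto intro!: cSup_eq_maximum)
  moreover have "y \<in> carrier c0 \<and> nrm c0 y \<le> 1 * C"
    if le: "\<And>n. norm (y n) \<le> C * (1/2) ^ n" for C and y :: "nat \<Rightarrow> 'k"
  proof
    show "y \<in> carrier c0"
      using le by (auto simp: c0_def abs_mult mult.commute intro!: tendsto_eq_intros
          tendsto_0_le[OF LIMSEQ_power_zero[of "1/2::real"], where K=C])
    \<comment> \<open>\<open>C\<close> is an arbitrary real; its sign comes from the hypothesis at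
      index 0, where the weight is 1.\<close>
    have "0 \<le> C"
      using order_trans[OF norm_ge_zero le[of 0]] by simp
    then have "norm (y n) \<le> C" for n
      using order_trans[OF le[of n] mult_left_le] by (simp add: power_le_one)
    then show "nrm c0 y \<le> 1 * C"
      by (auto simp: c0_def intro!: cSUP_least)
  qed
  then have "\<exists>K. \<forall>C y. (\<forall>n. norm (y n :: 'k) \<le> C * (1/2) ^ n) \<longrightarrow> y \<in> carrier c0 \<and> nrm c0 y \<le> K * C"
    by blast
  ultimately show ?thesis
    unfolding admissible_codomain_def by (simp add: c0_def)
qed

text \<open>The bound \<open>K = 2 powr (1/p)\<close> is the \<open>p\<close>-th root of the
  geometric sum 2, which dominates the \<open>p\<close>-th powers of the entries when
  \<open>C = 1\<close>.\<close>

lemma admissible_codomain_lp: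
  assumes p: "1 \<le> p"
  shows "admissible_codomain (lp p :: 'k::{real_normed_field,banach} sequence_space)"
proof -
  have "0 \<le> nrm (lp p) y \<and> (nrm (lp p) y = 0 \<longrightarrow> y = 0)"
    if "summable (\<lambda>n. norm (y n) powr p)" for y :: "nat \<Rightarrow> 'k"
    using suminf_eq_zero_iff[OF that] by (auto simp: lp_def fun_eq_iff)
  moreover have "nrm (lp p) (\<lambda>i. if i = n then c else 0) = norm c" for n and c :: 'k
  proof -
    have "(\<Sum>i. norm (if i = n then c else 0) powr p) = norm c powr p"
      using suminf_finite[of "{n}" "\<lambda>i. norm (if i = n then c else 0) powr p"] by simp
    then show ?thesis
      using p by (simp add: lp_def powr_powr)
  qed
  moreover have "y \<in> carrier (lp p) \<and> nrm (lp p) y \<le> 2 powr (1/p) * C"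
    if le: "\<And>n. norm (y n) \<le> C * (1/2) ^ n" for C and y :: "nat \<Rightarrow> 'k"
  proof -
    have C: "0 \<le> C"
      using order_trans[OF norm_ge_zero le[of 0]] by simp
    have bound: "norm (y n) powr p \<le> C powr p * (1/2) ^ n" for n
    proof -
      have "norm (y n) powr p \<le> (C * (1/2) ^ n) powr p"
        using le p by (intro powr_mono2) auto
      also have "\<dots> = C powr p * ((1/2) ^ n) powr p"
        using C by (simp add: powr_mult)
      \<comment> \<open>For a base in the unit interval, raising the exponent from 1 to
        \<open>p\<close> cannot increase the power. One geometric series of ratio \<open>1/2\<close>
        thus serves every \<open>p\<close>.\<close>
      also have "((1/2::real) ^ n) powr p \<le> ((1/2) ^ n) powr 1"
        using p by (intro powr_mono') (auto simp: power_le_one)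
      finally show ?thesis
        by (simp add: mult_left_mono)
    qed
    have geo: "(\<lambda>n. C powr p * (1/2::real) ^ n) sums (C powr p * 2)"
      using geometric_sums[of "1/2::real"] by (intro sums_mult) simp
    have summ: "summable (\<lambda>n. norm (y n) powr p)"
      by (rule summable_comparison_test'[OF sums_summable[OF geo], of 0]) (use bound in simp)
    have "(\<Sum>n. norm (y n) powr p) \<le> C powr p * 2"
      using suminf_le[OF bound summ sums_summable[OF geo]] geo by (simp add: sums_iff)
    then have "nrm (lp p) y \<le> (C powr p * 2) powr (1/p)"
      using p by (auto simp: lp_def intro!: powr_mono2 suminf_nonneg summ)
    also have "\<dots> = 2 powr (1/p) * C"
      using p C by (simp add: powr_mult powr_powr)
    finally show ?thesis
      using summ by (simp add: lp_def)
  qed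
  then have "\<exists>K. \<forall>C y. (\<forall>n. norm (y n :: 'k) \<le> C * (1/2) ^ n) \<longrightarrow> y \<in> carrier (lp p) \<and> nrm (lp p) y \<le> K * C"
    by blast
  ultimately show ?thesis
    unfolding admissible_codomain_def by (simp add: lp_def)
qed

theorem mainTheorem4:
  fixes p :: real
  assumes "1 \<le> p"
  shows
    "(\<not> weak_minimizing_property (lp 1 :: 'k::{real_normed_field,banach} sequence_space)
          (lp p :: 'k sequence_space)
      \<and> \<not> weak_minimizing_property (lp 1 :: 'k sequence_space) (c0 :: 'k sequence_space))
     \<and> \<not> weak_minimizing_property (c0 :: 'k sequence_space) (lp p :: 'k sequence_space)
     \<and> \<not> weak_minimizing_property (c0 :: 'k sequence_space) (c0 :: 'k sequence_space)"
  using admissible_codomain_lp[OF assms]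
  by (intro conjI not_weak_minimizing_property admissible_domain_l1 admissible_domain_c0
      admissible_codomain_c0)

end
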